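(* If $(P,\leq,{}',0,1)$ is a horizontal sum of Boolean posets and $a,b\in P$, then $a\mathrel{\mathrm C}b$ if and only if $c(a,b)=1$.
   Context: For a poset $(P,\leq)$ and $A\subseteq P$ put $L(A)=\{x\in P\mid x\leq y\text{ for all }y\in A\}$ and $U(A)=\{x\in P\mid y\leq x\text{ for all }y\in A\}$; for elements or subsets separated by commas one takes the union, e.g. $L(a,b)=L(\{a,b\})$, $L(A,b)=L(A\cup\{b\})$, $U(A,B)=U(A\cup B)$, and $LU(A)=L(U(A))$. $\operatorname{Min}A$ is the set of minimal elements of $A$ and $\operatorname{Min}U(\cdot)$ means $\operatorname{Min}(U(\cdot))$. Singletons are identified with their unique element. A poset is distributive if $L(U(x,y),z)=LU(L(x,z),L(y,z))$ for all $x,y,z$. A Boolean poset is a bounded distributive poset $(B,\leq,{}',0,1)$ with a unary operation $'$ that is a complementation: $L(x,x')=\{0\}$ and $U(x,x')=\{1\}$ for all $x$ (then $'$ is automatically an antitone involution). The horizontal sum of a non-empty family $(P_i,\leq,{}',0,1)$, $i\in I$, of bounded posets with an antitone involution is the poset $P$ that is the union of disjoint copies of the posets $P_i$ where the bottom elements of the $P_i$ are identified (to one element $0$) and the top elements of the $P_i$ are identified (to one element $1$); the order and $'$ are those inherited from the $P_i$. In $(P,\leq,{}',0,1)$: $a\mathrel{\mathrm C}b$ means $U(a)=U(L(a,b),L(a,b'))$, and $c(a,b)=\operatorname{Min}U(L(a,b),L(a,b'),L(a',b),L(a',b'))$. *)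

theory Defs
  imports "HOL-Algebra.Order"
begin

text \<open>
  Posets are those of \<^theory>\<open>HOL-Algebra.Order\<close>, where $L(A)$ and $U(A)$ are \<^const>\<open>Lower\<close> and
  \<^const>\<open>Upper\<close>. The elements $0$ and $1$ are \<^const>\<open>bottom\<close> and \<^const>\<open>top\<close>, which are unique as
  soon as the underlying structure satisfies \<^const>\<open>partial_order\<close>. The one-element poset, in
  which $0 = 1$, is not excluded.
\<close>

record 'a ogorder = "'a gorder" +
  ocompl :: "'a \<Rightarrow> 'a"

locale bounded_poset =
  partial_order L + weak_partial_order_bottom L + weak_partial_order_top L for L (structure)

locale bounded_involution_poset =
  bounded_poset P for P :: "('a, 'm) ogorder_scheme" (structure) +
  assumes ocompl_closed: "x \<in> carrier P \<Longrightarrow> ocompl P x \<in> carrier P"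
    and ocompl_antitone:
      "\<lbrakk>x \<in> carrier P; y \<in> carrier P; x \<sqsubseteq> y\<rbrakk> \<Longrightarrow> ocompl P y \<sqsubseteq> ocompl P x"
    and ocompl_involution: "x \<in> carrier P \<Longrightarrow> ocompl P (ocompl P x) = x"

definition distributive_poset :: "('a, 'm) gorder_scheme \<Rightarrow> bool" where
  "distributive_poset P \<longleftrightarrow>
     (\<forall>x\<in>carrier P. \<forall>y\<in>carrier P. \<forall>z\<in>carrier P.
        Lower P (Upper P {x, y} \<union> {z}) =
        Lower P (Upper P (Lower P {x, z} \<union> Lower P {y, z})))"

locale boolean_poset =
  bounded_poset B for B :: "('a, 'm) ogorder_scheme" (structure) +
  assumes distributive: "distributive_poset B"
    and ocompl_in_carrier: "x \<in> carrier B \<Longrightarrow> ocompl B x \<in> carrier B"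
    and Lower_ocompl: "x \<in> carrier B \<Longrightarrow> Lower B {x, ocompl B x} = {\<bottom>}"
    and Upper_ocompl: "x \<in> carrier B \<Longrightarrow> Upper B {x, ocompl B x} = {\<top>}"

definition minimal_elements :: "('a, 'm) gorder_scheme \<Rightarrow> 'a set \<Rightarrow> 'a set" where
  "minimal_elements P A = {x \<in> A. \<forall>y\<in>A. y \<sqsubseteq>\<^bsub>P\<^esub> x \<longrightarrow> y = x}"

text \<open>
  A horizontal sum is characterised up to isomorphism: the map \<open>e i\<close> identifies the summand
  \<open>Q i\<close> with its copy inside \<open>P\<close>. The copies cover \<open>P\<close>, they are disjoint except that all bottom
  elements and all top elements are identified, and two elements of \<open>P\<close> are comparable only if
  they are so within a common copy.

  If $0 = 1$ in one summand, these conditions force $0 = 1$ in every summand; a family with both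
  one-element and larger members has no horizontal sum.
\<close>

definition horizontal_sum ::
    "('a, 'm) ogorder_scheme \<Rightarrow> 'i set \<Rightarrow> ('i \<Rightarrow> ('b, 'n) ogorder_scheme) \<Rightarrow> bool" where
  "horizontal_sum P I Q \<longleftrightarrow>
     I \<noteq> {} \<and> (\<forall>i\<in>I. bounded_involution_poset (Q i)) \<and>
     bounded_poset P \<and>
     (\<exists>e. (\<forall>i\<in>I. inj_on (e i) (carrier (Q i))
               \<and> e i \<bottom>\<^bsub>Q i\<^esub> = \<bottom>\<^bsub>P\<^esub> \<and> e i \<top>\<^bsub>Q i\<^esub> = \<top>\<^bsub>P\<^esub>
               \<and> (\<forall>u\<in>carrier (Q i). e i (ocompl (Q i) u) = ocompl P (e i u))) \<and>
          carrier P = (\<Union>i\<in>I. e i ` carrier (Q i)) \<and>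
          (\<forall>i\<in>I. \<forall>j\<in>I. i \<noteq> j \<longrightarrow>
             e i ` carrier (Q i) \<inter> e j ` carrier (Q j) = {\<bottom>\<^bsub>P\<^esub>, \<top>\<^bsub>P\<^esub>}) \<and>
          (\<forall>x\<in>carrier P. \<forall>y\<in>carrier P. x \<sqsubseteq>\<^bsub>P\<^esub> y \<longleftrightarrow>
             (\<exists>i\<in>I. \<exists>u\<in>carrier (Q i). \<exists>v\<in>carrier (Q i).
                x = e i u \<and> y = e i v \<and> u \<sqsubseteq>\<^bsub>Q i\<^esub> v)))"

definition commutes :: "('a, 'm) ogorder_scheme \<Rightarrow> 'a \<Rightarrow> 'a \<Rightarrow> bool" where
  "commutes P a b \<longleftrightarrow> Upper P {a} = Upper P (Lower P {a, b} \<union> Lower P {a, ocompl P b})"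

definition commutator :: "('a, 'm) ogorder_scheme \<Rightarrow> 'a \<Rightarrow> 'a \<Rightarrow> 'a set" where
  "commutator P a b = minimal_elements P (Upper P
     (Lower P {a, b} \<union> Lower P {a, ocompl P b} \<union>
      Lower P {ocompl P a, b} \<union> Lower P {ocompl P a, ocompl P b}))"

text \<open>
  The complementation of a Boolean poset is automatically an antitone involution, so Boolean
  posets are admissible summands of a horizontal sum.
\<close>

sublocale boolean_poset \<subseteq> bounded_involution_poset B
proof
  show "x \<in> carrier B \<Longrightarrow> ocompl B x \<in> carrier B" for x by (rule ocompl_in_carrier)
  have le: "z \<sqsubseteq> w"
    if x: "x \<in> carrier B" and z: "z \<in> carrier B" and w: "w \<in> carrier B"
      and disj: "\<And>t. \<lbrakk>t \<in> carrier B; t \<sqsubseteq> x; t \<sqsubseteq> z\<rbrakk> \<Longrightarrow> t \<sqsubseteq> w"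
      and below: "\<And>t. \<lbrakk>t \<in> carrier B; t \<sqsubseteq> ocompl B x; t \<sqsubseteq> z\<rbrakk> \<Longrightarrow> t \<sqsubseteq> w"
    for x z w
  proof -
    have "z \<in> Lower B (Upper B {x, ocompl B x} \<union> {z})"
      using z top_higher by (auto simp: Upper_ocompl[OF x] Lower_def)
    then have "z \<in> Lower B (Upper B (Lower B {x, z} \<union> Lower B {ocompl B x, z}))"
      using distributive x z ocompl_in_carrier[OF x] unfolding distributive_poset_def by blast
    moreover have "w \<in> Upper B (Lower B {x, z} \<union> Lower B {ocompl B x, z})"
      using w disj below x z ocompl_in_carrier[OF x] by (auto simp: Upper_def Lower_def)
    ultimately show ?thesis
      using w by (auto simp: Lower_def)
  qed
  have bot: "t \<sqsubseteq> w"
    if "x \<in> carrier B" "t \<in> carrier B" "w \<in> carrier B" "t \<sqsubseteq> x" "t \<sqsubseteq> ocompl B x" for t w x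
  proof -
    have "t \<in> Lower B {x, ocompl B x}"
      using that by (auto simp: Lower_def)
    then show ?thesis
      using that bottom_lower by (simp add: Lower_ocompl)
  qed
  show "ocompl B y \<sqsubseteq> ocompl B x" if "x \<in> carrier B" "y \<in> carrier B" "x \<sqsubseteq> y" for x y
    by (rule le[of x]) (use that ocompl_in_carrier in \<open>auto intro: bot[of y] le_trans\<close>)
  show "ocompl B (ocompl B x) = x" if x: "x \<in> carrier B" for x
  proof (rule le_antisym)
    show "ocompl B (ocompl B x) \<sqsubseteq> x"
      by (rule le[of x]) (use x ocompl_in_carrier in \<open>auto intro: bot[of "ocompl B x"]\<close>)
    show "x \<sqsubseteq> ocompl B (ocompl B x)"
      by (rule le[of "ocompl B x"]) (use x ocompl_in_carrier in \<open>auto intro: bot[of x]\<close>)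
  qed (use x ocompl_in_carrier in auto)
qed

end

theory Submission
  imports Defs
begin

text \<open>
  If \<open>a\<close> and \<open>b\<close> lie in a common summand, both sides hold: distributivity gives that \<open>a\<close> is
  the join of \<open>L(a, b) \<union> L(a, b')\<close> in the summand, likewise for \<open>a'\<close>, and a join in a summand
  remains a join in the sum, because an upper bound outside the summand forces the set, hence its
  join, to be \<open>0\<close>. If \<open>a\<close> and \<open>b\<close> have no common summand, then \<open>0\<close> is the only common lower
  bound of any of \<open>a, a'\<close> with any of \<open>b, b'\<close>, and both sides fail.
\<close>

section \<open>Bounded posets and distributivity\<close>

context bounded_poset
begin

lemma le_bottom_iff: "x \<in> carrier L \<Longrightarrow> x \<sqsubseteq> \<bottom> \<longleftrightarrow> x = \<bottom>"
  by (metis bottom_closed bottom_lower le_antisym le_refl)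

lemma top_le_iff: "x \<in> carrier L \<Longrightarrow> \<top> \<sqsubseteq> x \<longleftrightarrow> x = \<top>"
  by (metis top_closed top_higher le_antisym le_refl)

text \<open>Everything in \<open>A\<close> lies below \<top>, so minimality of \<top> in
  \<open>A\<close> leaves no other element. This removes the minimal elements from the equation c(a,
  b) = 1 and leaves one about upper bounds.\<close>

lemma minimal_elements_eq_top_iff:
  assumes "A \<subseteq> carrier L"
  shows "minimal_elements L A = {\<top>} \<longleftrightarrow> A = {\<top>}"
proof
  assume "minimal_elements L A = {\<top>}"
  then have "\<top> \<in> minimal_elements L A" by simp
  then show "A = {\<top>}"
    using assms top_higher by (auto simp: minimal_elements_def)
qed (auto simp: minimal_elements_def)

end

text \<open>Distributivity for \<open>v\<close>, \<open>v'\<close>, \<open>u\<close>: since U(v, v')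
  = {1}, its left side is L(1, u), which contains \<open>u\<close>. This is the nontrivial half of
  \<open>u\<close> C \<open>v\<close> in a Boolean poset.\<close>

lemma (in boolean_poset) le_Upper_Lower_ocompl:
  assumes u: "u \<in> carrier B" and v: "v \<in> carrier B"
    and t: "t \<in> Upper B (Lower B {u, v} \<union> Lower B {u, ocompl B v})"
  shows "u \<sqsubseteq> t"
proof -
  have "u \<in> Lower B (Upper B {v, ocompl B v} \<union> {u})"
    using u top_higher by (auto simp: Upper_ocompl[OF v] Lower_def)
  also have "\<dots> = Lower B (Upper B (Lower B {v, u} \<union> Lower B {ocompl B v, u}))"
    by (rule distributive[unfolded distributive_poset_def, rule_format])
      (use u v ocompl_in_carrier in auto)
  finally have "u \<in> Lower B (Upper B (Lower B {u, v} \<union> Lower B {u, ocompl B v}))"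
    by (simp only: insert_commute)
  then show ?thesis
    using Lower_memD[OF _ t Upper_closed] by blast
qed

text \<open>Fixes a witness \<open>e\<close> for the existential in \<open>horizontal_sum\<close>.
  Summands merely carry an antitone involution here; lemmas about Boolean summands assume that
  themselves.\<close>

locale horizontal_sum_embedding =
  bounded_poset P for P :: "('a, 'm) ogorder_scheme" (structure) +
  fixes I :: "'i set" and Q :: "'i \<Rightarrow> ('b, 'n) ogorder_scheme" and e :: "'i \<Rightarrow> 'b \<Rightarrow> 'a"
  assumes summand: "i \<in> I \<Longrightarrow> bounded_involution_poset (Q i)"
    and inj: "i \<in> I \<Longrightarrow> inj_on (e i) (carrier (Q i))"
    and e_bottom: "i \<in> I \<Longrightarrow> e i \<bottom>\<^bsub>Q i\<^esub> = \<bottom>"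
    and e_top: "i \<in> I \<Longrightarrow> e i \<top>\<^bsub>Q i\<^esub> = \<top>"
    and e_ocompl: "\<lbrakk>i \<in> I; u \<in> carrier (Q i)\<rbrakk> \<Longrightarrow> e i (ocompl (Q i) u) = ocompl P (e i u)"
    and carrier_eq: "carrier P = (\<Union>i\<in>I. e i ` carrier (Q i))"
    and disjoint: "\<lbrakk>i \<in> I; j \<in> I; i \<noteq> j\<rbrakk> \<Longrightarrow>
      e i ` carrier (Q i) \<inter> e j ` carrier (Q j) = {\<bottom>, \<top>}"
    and le_iff: "\<lbrakk>x \<in> carrier P; y \<in> carrier P\<rbrakk> \<Longrightarrow> x \<sqsubseteq> y \<longleftrightarrow>
      (\<exists>i\<in>I. \<exists>u\<in>carrier (Q i). \<exists>v\<in>carrier (Q i). x = e i u \<and> y = e i v \<and> u \<sqsubseteq>\<^bsub>Q i\<^esub> v)"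
begin

section \<open>Blocks of a horizontal sum, their order and their bounds\<close>

definition "block i = e i ` carrier (Q i)"

text \<open>Not transitive in general: \<bottom> and \<top> share a block with every
  element.\<close>

definition "same_block x y \<longleftrightarrow> (\<exists>i\<in>I. x \<in> block i \<and> y \<in> block i)"

lemma e_closed: "\<lbrakk>i \<in> I; u \<in> carrier (Q i)\<rbrakk> \<Longrightarrow> e i u \<in> carrier P"
  using carrier_eq by blast

lemma e_in_block: "u \<in> carrier (Q i) \<Longrightarrow> e i u \<in> block i"
  by (simp add: block_def)

lemma in_some_block: "x \<in> carrier P \<Longrightarrow> \<exists>i\<in>I. x \<in> block i"
  using carrier_eq by (auto simp: block_def)

lemma block_subset: "i \<in> I \<Longrightarrow> block i \<subseteq> carrier P"
  by (auto simp: block_def e_closed)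

lemma bottom_in_block: "i \<in> I \<Longrightarrow> \<bottom> \<in> block i"
  and top_in_block: "i \<in> I \<Longrightarrow> \<top> \<in> block i"
proof -
  assume i: "i \<in> I"
  interpret Qi: bounded_involution_poset "Q i" using summand[OF i] .
  show "\<bottom> \<in> block i" "\<top> \<in> block i"
    unfolding block_def
    using e_bottom[OF i] e_top[OF i] Qi.bottom_closed Qi.top_closed by (metis imageI)+
qed

lemma in_two_blocks:
  "\<lbrakk>i \<in> I; j \<in> I; i \<noteq> j; x \<in> block i; x \<in> block j\<rbrakk> \<Longrightarrow> x = \<bottom> \<or> x = \<top>"
  using disjoint[of i j] by (auto simp: block_def)

lemma le_same_block: "\<lbrakk>x \<in> carrier P; y \<in> carrier P; x \<sqsubseteq> y\<rbrakk> \<Longrightarrow> same_block x y"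
  by (auto simp: le_iff same_block_def block_def)

lemma same_block_commute: "same_block x y \<longleftrightarrow> same_block y x"
  by (auto simp: same_block_def)

lemma ocompl_in_block: "\<lbrakk>i \<in> I; x \<in> block i\<rbrakk> \<Longrightarrow> ocompl P x \<in> block i"
  using bounded_involution_poset.ocompl_closed[OF summand]
  by (force simp: block_def simp flip: e_ocompl)

lemma ocompl_closed: "x \<in> carrier P \<Longrightarrow> ocompl P x \<in> carrier P"
  by (meson in_some_block ocompl_in_block block_subset subsetD)

lemma ocompl_involution:
  assumes "x \<in> carrier P"
  shows "ocompl P (ocompl P x) = x"
proof -
  obtain i u where i: "i \<in> I" and u: "u \<in> carrier (Q i)" "x = e i u"
    using in_some_block[OF assms] by (auto simp: block_def)
  interpret Qi: bounded_involution_poset "Q i" using summand[OF i] .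
  show ?thesis
    using u Qi.ocompl_closed Qi.ocompl_involution by (simp flip: e_ocompl[OF i])
qed

text \<open>Blocks are closed under the involution, and applying it twice gives the converse. Hence
  all four pairs in the commutator share a block or none does.\<close>

lemma same_block_ocompl:
  "x \<in> carrier P \<Longrightarrow> same_block (ocompl P x) y \<longleftrightarrow> same_block x y"
  using ocompl_in_block ocompl_involution unfolding same_block_def by metis

text \<open>A comparison in \<open>P\<close> may be witnessed by another summand \<open>j\<close>.
  Then both images lie in two blocks, so each is \<bottom> or \<top>, and the comparison can be
  checked directly.\<close>

lemma e_le_iff:
  assumes i: "i \<in> I" and u: "u \<in> carrier (Q i)" and v: "v \<in> carrier (Q i)"
  shows "e i u \<sqsubseteq> e i v \<longleftrightarrow> u \<sqsubseteq>\<^bsub>Q i\<^esub> v"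
proof
  assume "e i u \<sqsubseteq> e i v"
  then obtain j s t where j: "j \<in> I" "s \<in> carrier (Q j)" "t \<in> carrier (Q j)"
    and eq: "e i u = e j s" "e i v = e j t" and st: "s \<sqsubseteq>\<^bsub>Q j\<^esub> t"
    using le_iff e_closed i u v by meson
  interpret Qi: bounded_involution_poset "Q i" using summand[OF i] .
  interpret Qj: bounded_involution_poset "Q j" using summand[OF j(1)] .
  note inj_i = inj_onD[OF inj[OF i]] and inj_j = inj_onD[OF inj[OF j(1)]]
  show "u \<sqsubseteq>\<^bsub>Q i\<^esub> v"
  proof (cases "i = j")
    case True
    then show ?thesis using eq st u v j inj_i by metis
  next
    case False
    have uv: "e i u = \<bottom> \<or> e i u = \<top>" "e i v = \<bottom> \<or> e i v = \<top>"
      using in_two_blocks[OF i j(1) False] eq u v j e_in_block by metis+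
    show ?thesis
    proof (cases "e i u = \<bottom> \<or> e i v = \<top>")
      case True
      then have "u = \<bottom>\<^bsub>Q i\<^esub> \<or> v = \<top>\<^bsub>Q i\<^esub>"
        using inj_i e_bottom[OF i] e_top[OF i] u v Qi.bottom_closed Qi.top_closed by metis
      then show ?thesis using u v Qi.bottom_lower Qi.top_higher by blast
    next
      case False
      \<comment> \<open>What remains is \<open>e i u\<close> = \<top> and \<open>e i v\<close> =
        \<bottom>. Then \<top> = \<bottom>, contradicting the case assumption.\<close>
      then have "\<top> \<sqsubseteq> \<bottom>" using uv \<open>e i u \<sqsubseteq> e i v\<close> by simp
      then show ?thesis using False uv le_bottom_iff top_closed by metis
    qed
  qed
next
  assume "u \<sqsubseteq>\<^bsub>Q i\<^esub> v"
  then show "e i u \<sqsubseteq> e i v"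
    using le_iff[OF e_closed[OF i u] e_closed[OF i v]] i u v by metis
qed

text \<open>Together with the fact that \<open>e i\<close> is an order embedding, this says that suprema in a
  summand are suprema in the sum.\<close>
lemma e_le_Upper:
  assumes i: "i \<in> I" and u: "u \<in> carrier (Q i)" and A: "A \<subseteq> carrier (Q i)"
    and u_le: "\<And>t. t \<in> Upper (Q i) A \<Longrightarrow> u \<sqsubseteq>\<^bsub>Q i\<^esub> t"
    and w: "w \<in> Upper P (e i ` A)"
  shows "e i u \<sqsubseteq> w"
proof -
  interpret Qi: bounded_involution_poset "Q i" using summand[OF i] .
  have w_carrier: "w \<in> carrier P" using w by (simp add: Upper_def)
  have below: "e i t \<sqsubseteq> w" if "t \<in> A" for t
    using w that A e_closed[OF i] by (auto simp: Upper_def)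
  show ?thesis
  proof (cases "w \<in> block i")
    case True
    then obtain t where t: "t \<in> carrier (Q i)" "w = e i t" by (auto simp: block_def)
    then have "t \<in> Upper (Q i) A"
      using below A e_le_iff[OF i] by (metis Upper_memI subsetD)
    then show ?thesis using u_le e_le_iff[OF i u] t by simp
  next
    case False
    \<comment> \<open>The elements \<open>e i t\<close> and \<open>w\<close> share a block other
      than \<open>block i\<close>, so \<open>e i t\<close> is \<bottom> or \<top>; the latter would
      force \<open>w\<close> = \<top>, which lies in \<open>block i\<close>.\<close>
    have "t = \<bottom>\<^bsub>Q i\<^esub>" if t: "t \<in> A" for t
    proof -
      have et: "e i t \<in> carrier P" "e i t \<in> block i"
        using t A e_closed[OF i] by (auto simp: block_def)
      obtain j where j: "j \<in> I" "e i t \<in> block j" "w \<in> block j"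
        using le_same_block[OF et(1) w_carrier below[OF t]] by (auto simp: same_block_def)
      then have "e i t = \<bottom> \<or> e i t = \<top>"
        using in_two_blocks[OF i j(1)] et False by blast
      moreover have "e i t \<noteq> \<top>"
        using below[OF t] top_le_iff[OF w_carrier] False top_in_block[OF i] by auto
      ultimately show ?thesis
        using inj_onD[OF inj[OF i]] e_bottom[OF i] t A Qi.bottom_closed by (metis subsetD)
    qed
    then have "\<bottom>\<^bsub>Q i\<^esub> \<in> Upper (Q i) A"
      using Qi.bottom_closed by (auto simp: Upper_def)
    then have "u = \<bottom>\<^bsub>Q i\<^esub>" using u_le Qi.le_bottom_iff[OF u] by blast
    then show ?thesis using e_bottom[OF i] bottom_lower w_carrier by simp
  qed
qed

lemma e_Lower_subset:
  assumes i: "i \<in> I" and "u \<in> carrier (Q i)" "v \<in> carrier (Q i)"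
  shows "e i ` Lower (Q i) {u, v} \<subseteq> Lower P {e i u, e i v}"
  using assms e_le_iff e_closed by (auto simp: Lower_def)

text \<open>A common lower bound shares a block with \<open>x\<close> and a block with
  \<open>y\<close>. These blocks differ, so it is \<bottom> or \<top>; if it were \<top>, then
  \<open>x\<close> = \<top> would share a block with \<open>y\<close>.\<close>

lemma Lower_no_common_block:
  assumes x: "x \<in> carrier P" and y: "y \<in> carrier P" and xy: "\<not> same_block x y"
  shows "Lower P {x, y} = {\<bottom>}"
proof -
  have "z = \<bottom>" if z: "z \<in> carrier P" "z \<sqsubseteq> x" "z \<sqsubseteq> y" for z
  proof -
    have "same_block z x" "same_block z y"
      using le_same_block z x y by auto
    then have "z = \<bottom> \<or> z = \<top>"
      using xy in_two_blocks unfolding same_block_def by metis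
    moreover have "z \<noteq> \<top>"
      using z xy x in_some_block[OF y] top_in_block top_le_iff same_block_def by metis
    ultimately show ?thesis by blast
  qed
  then show ?thesis
    using x y bottom_closed bottom_lower by (auto simp: Lower_def)
qed

section \<open>Commutation and the commutator of two elements\<close>

lemma commutes_if_same_block:
  assumes boolean: "\<And>i. i \<in> I \<Longrightarrow> boolean_poset (Q i)" and "same_block a b"
  shows "commutes P a b"
proof -
  obtain i u v where i: "i \<in> I" and u: "u \<in> carrier (Q i)" "a = e i u"
    and v: "v \<in> carrier (Q i)" "b = e i v"
    using \<open>same_block a b\<close> by (auto simp: same_block_def block_def)
  interpret Qi: boolean_poset "Q i" using boolean[OF i] .
  let ?v' = "ocompl (Q i) v"
  have v': "?v' \<in> carrier (Q i)" "ocompl P b = e i ?v'"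
    using e_ocompl[OF i v(1)] v Qi.ocompl_in_carrier by simp_all
  have a: "a \<in> carrier P" using e_closed i u by simp
  let ?A = "Lower (Q i) {u, v} \<union> Lower (Q i) {u, ?v'}"
  \<comment> \<open>As \<open>Upper\<close> is antitone, upper bounds of the lower sets in
    \<open>P\<close> become upper bounds of the image of \<open>?A\<close>, to which
    \<open>e_le_Upper\<close> applies.\<close>
  have sub: "e i ` ?A \<subseteq> Lower P {a, b} \<union> Lower P {a, ocompl P b}"
    \<comment> \<open>The term \<open>ocompl P b\<close> is rewritten first, since unfolding
      \<open>b\<close> would destroy the left-hand side of \<open>v'(2)\<close>.\<close>
    unfolding image_Un v'(2) unfolding u(2) v(2)
    by (intro Un_mono e_Lower_subset i u(1) v(1) v'(1))
  show ?thesis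
    unfolding commutes_def
  proof
    show "Upper P {a} \<subseteq> Upper P (Lower P {a, b} \<union> Lower P {a, ocompl P b})"
    proof (intro subsetI Upper_memI)
      fix w y
      assume w: "w \<in> Upper P {a}"
      then show w_carrier: "w \<in> carrier P" by (simp add: Upper_def)
      assume "y \<in> Lower P {a, b} \<union> Lower P {a, ocompl P b}"
      then have "y \<in> carrier P" "y \<sqsubseteq> a"
        using a by (auto simp: Lower_def)
      moreover have "a \<sqsubseteq> w" using w a by (simp add: Upper_def)
      ultimately show "y \<sqsubseteq> w" using a w_carrier le_trans by blast
    qed
    show "Upper P (Lower P {a, b} \<union> Lower P {a, ocompl P b}) \<subseteq> Upper P {a}"
    proof
      fix w assume w: "w \<in> Upper P (Lower P {a, b} \<union> Lower P {a, ocompl P b})"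
      then have w_upper: "w \<in> Upper P (e i ` ?A)"
        using subsetD[OF Upper_antimono[OF sub]] by simp
      have "e i u \<sqsubseteq> w"
        by (rule e_le_Upper[OF i u(1) _ _ w_upper])
          (simp_all add: Qi.le_Upper_Lower_ocompl[OF u(1) v(1)])
      then show "w \<in> Upper P {a}"
        using w u(2) by (simp add: Upper_def)
    qed
  qed
qed

text \<open>In the summand, 1 is the join of \<open>u\<close> and its complement;
  \<open>e_le_Upper\<close> carries this join over to \<open>P\<close>.\<close>

lemma Upper_ocompl:
  assumes boolean: "\<And>i. i \<in> I \<Longrightarrow> boolean_poset (Q i)" and a: "a \<in> carrier P"
  shows "Upper P {a, ocompl P a} = {\<top>}"
proof -
  obtain i u where i: "i \<in> I" and u: "u \<in> carrier (Q i)" "a = e i u"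
    using in_some_block[OF a] by (auto simp: block_def)
  interpret Qi: boolean_poset "Q i" using boolean[OF i] .
  have img: "{a, ocompl P a} = e i ` {u, ocompl (Q i) u}"
    using e_ocompl[OF i u(1)] u by simp
  have "w = \<top>" if w: "w \<in> Upper P {a, ocompl P a}" for w
  proof -
    have "e i \<top>\<^bsub>Q i\<^esub> \<sqsubseteq> w"
      by (rule e_le_Upper[OF i _ _ _ w[unfolded img]])
        (use u Qi.ocompl_in_carrier Qi.top_closed Qi.Upper_ocompl[OF u(1)] in auto)
    then show ?thesis
      using w e_top[OF i] top_le_iff by (auto simp: Upper_def)
  qed
  then show ?thesis
    using a ocompl_closed top_closed top_higher by (auto simp: Upper_def)
qed

lemma commutator_eq_top_iff:
  "commutator P a b = {\<top>} \<longleftrightarrow>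
     Upper P (Lower P {a, b} \<union> Lower P {a, ocompl P b} \<union>
       Lower P {ocompl P a, b} \<union> Lower P {ocompl P a, ocompl P b}) = {\<top>}"
  unfolding commutator_def by (rule minimal_elements_eq_top_iff) (simp add: Upper_def)

lemma commutator_if_same_block:
  assumes boolean: "\<And>i. i \<in> I \<Longrightarrow> boolean_poset (Q i)"
    and a: "a \<in> carrier P" and ab: "same_block a b"
  shows "commutator P a b = {\<top>}"
proof -
  let ?S = "Lower P {a, b} \<union> Lower P {a, ocompl P b} \<union>
    Lower P {ocompl P a, b} \<union> Lower P {ocompl P a, ocompl P b}"
  \<comment> \<open>The complement of \<open>a\<close> also shares a block with \<open>b\<close>.
    The lower sets in these two commutation statements together make up \<open>?S\<close>, so any
    upper bound of \<open>?S\<close> lies above \<open>a\<close> and its complement.\<close>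
  have "commutes P a b" "commutes P (ocompl P a) b"
    using commutes_if_same_block[OF boolean] ab same_block_ocompl[OF a] by auto
  then have "Upper P ?S \<subseteq> Upper P {a}" "Upper P ?S \<subseteq> Upper P {ocompl P a}"
    unfolding commutes_def by (simp_all only:) (rule Upper_antimono, blast)+
  then have "Upper P ?S \<subseteq> Upper P {a, ocompl P a}"
    by (auto simp: Upper_def)
  then have "Upper P ?S \<subseteq> {\<top>}"
    by (simp only: Upper_ocompl[OF boolean a])
  moreover have "\<top> \<in> Upper P ?S"
    by (rule Upper_memI) (auto simp: Lower_def)
  ultimately show ?thesis
    unfolding commutator_eq_top_iff by blast
qed

text \<open>All four lower sets collapse to {0}, so both sets of upper bounds become the whole
  carrier. This differs from U(a) and from {1} because \<open>a\<close> is not 0.\<close>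

lemma not_commuting_if_no_common_block:
  assumes a: "a \<in> carrier P" and b: "b \<in> carrier P" and ab: "\<not> same_block a b"
  shows "\<not> commutes P a b" and "commutator P a b \<noteq> {\<top>}"
proof -
  \<comment> \<open>Otherwise \<open>a\<close> would lie in every block, in particular in one
    containing \<open>b\<close>.\<close>
  have a_bottom: "a \<noteq> \<bottom>"
    using ab in_some_block[OF b] bottom_in_block same_block_def by metis
  have no_block: "\<not> same_block a (ocompl P b)" "\<not> same_block (ocompl P a) b"
    "\<not> same_block (ocompl P a) (ocompl P b)"
    using ab a b same_block_ocompl same_block_commute by metis+
  note Lower_bottom = Lower_no_common_block[OF a b ab]
    Lower_no_common_block[OF a ocompl_closed[OF b] no_block(1)]
    Lower_no_common_block[OF ocompl_closed[OF a] b no_block(2)]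
    Lower_no_common_block[OF ocompl_closed[OF a] ocompl_closed[OF b] no_block(3)]
  have Upper_bottom: "Upper P {\<bottom>} = carrier P"
    using bottom_lower by (auto simp: Upper_def)
  have "\<bottom> \<notin> Upper P {a}"
    using a a_bottom le_bottom_iff by (auto simp: Upper_def)
  then show "\<not> commutes P a b"
    using bottom_closed by (auto simp: commutes_def Lower_bottom Upper_bottom)
  \<comment> \<open>The carrier has the two distinct elements \<open>a\<close> and
    \<bottom>.\<close>
  have "carrier P \<noteq> {\<top>}"
    using a a_bottom bottom_closed by (metis singletonD)
  then show "commutator P a b \<noteq> {\<top>}"
    by (simp add: commutator_eq_top_iff Lower_bottom Upper_bottom)
qed

end

lemma horizontal_sum_embedding_exists:
  assumes "horizontal_sum P I Q"
  shows "\<exists>e. horizontal_sum_embedding P I Q e"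
  using assms unfolding horizontal_sum_def
  apply (elim conjE exE)
  subgoal for e
    unfolding horizontal_sum_embedding_def horizontal_sum_embedding_axioms_def
    by (intro exI[of _ e] conjI allI impI) (simp_all del: UN_iff UN_ball_bex_simps)
  done

theorem corollary4p13:
  fixes P :: "'a ogorder" and I :: "'i set" and Q :: "'i \<Rightarrow> 'b ogorder" and a b :: 'a
  assumes "\<And>i. i \<in> I \<Longrightarrow> boolean_poset (Q i)"
    and "horizontal_sum P I Q"
    and "a \<in> carrier P" and "b \<in> carrier P"
  shows "commutes P a b \<longleftrightarrow> commutator P a b = {\<top>\<^bsub>P\<^esub>}"
proof -
  obtain e where "horizontal_sum_embedding P I Q e"
    using horizontal_sum_embedding_exists[OF assms(2)] by blast
  then interpret horizontal_sum_embedding P I Q e .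
  show ?thesis
  proof (cases "same_block a b")
    case True
    then show ?thesis
      using commutes_if_same_block commutator_if_same_block assms(1,3) by simp
  next
    case False
    then show ?thesis
      using not_commuting_if_no_common_block assms(3,4) by simp
  qed
qed

end
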